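(* Let $I$ be a set and let $R \subseteq I^2$ be an equivalence relation on $I$. Let $R^s \subseteq (\beta I)^2$ be the strong extension of $R$. The following are equivalent: (i) $R^s$ is an equivalence relation on $\beta I$; (ii) $R^s$ is reflexive; (iii) $R^s$ is symmetric and total; (iv) $R^s$ is total.
   Context: $\beta I$ denotes the set of all ultrafilters on $I$. For a binary relation $R\subseteq I^2$, the strong extension $R^s\subseteq(\beta I)^2$ is defined by: $R^s(u,v)$ holds if and only if $\{a\in I \mid \{b\in I\mid R(a,b)\}\in v\}\in u$. A binary relation $S\subseteq X\times Y$ is called total when for every $x\in X$ there exists $y\in Y$ such that $S(x,y)$ holds. *)

theory Defs
  imports Main
begin

definition is_filter_on :: "'a set \<Rightarrow> 'a set set \<Rightarrow> bool" where
  "is_filter_on I F \<longleftrightarrow>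
     F \<subseteq> Pow I \<and> I \<in> F \<and>
     (\<forall>A\<in>F. \<forall>B\<in>F. A \<inter> B \<in> F) \<and>
     (\<forall>A\<in>F. \<forall>B. A \<subseteq> B \<and> B \<subseteq> I \<longrightarrow> B \<in> F)"

(* Ultrafilters are families of subsets of the carrier set I; the library type of filters
   only covers filters on a whole type. No assumption is made on I, and
   beta_ultrafilters {} = {}. *)
definition beta_ultrafilters :: "'a set \<Rightarrow> 'a set set set" where
  "beta_ultrafilters I =
     {u. is_filter_on I u \<and> {} \<notin> u \<and> (\<forall>A. A \<subseteq> I \<longrightarrow> A \<in> u \<or> I - A \<in> u)}"

definition strong_extension :: "'a set \<Rightarrow> ('a \<times> 'a) set \<Rightarrow> ('a set set \<times> 'a set set) set" where
  "strong_extension I R =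
     {(u, v). u \<in> beta_ultrafilters I \<and> v \<in> beta_ultrafilters I \<and>
        {a \<in> I. {b \<in> I. (a, b) \<in> R} \<in> v} \<in> u}"

(* Every element of X is related to something in Y; unrelated to the library constant
   total_on, which says that any two distinct elements are comparable. *)
definition total_relation :: "'a set \<Rightarrow> 'b set \<Rightarrow> ('a \<times> 'b) set \<Rightarrow> bool" where
  "total_relation X Y S \<longleftrightarrow> (\<forall>x\<in>X. \<exists>y\<in>Y. (x, y) \<in> S)"

end

(* If R is an equivalence relation, at most one R-class belongs to a given ultrafilter v, so
   {a. the class of a belongs to v} is that class or empty. Hence u and v are related by the
   strong extension iff they share an R-class, which is always symmetric and transitive;
   reflexivity and totality both say that every ultrafilter contains some R-class. *)
theory Submission
  imports Defs
begin

lemma beta_ultrafilters_Int_nonempty: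
  assumes "u \<in> beta_ultrafilters I" "A \<in> u" "B \<in> u"
  shows "A \<inter> B \<noteq> {}"
  using assms unfolding beta_ultrafilters_def is_filter_on_def by force

text \<open>Distinct classes are disjoint, whereas two members of an ultrafilter always
  meet.\<close>

lemma beta_ultrafilters_quotient_unique:
  assumes "equiv I R" "u \<in> beta_ultrafilters I"
    and "C \<in> I // R" "D \<in> I // R" "C \<in> u" "D \<in> u"
  shows "C = D"
  using quotient_disj[OF assms(1,3,4)] beta_ultrafilters_Int_nonempty[OF assms(2,5,6)] by blast

text \<open>Trades the nested membership condition, in which \<open>u\<close> and \<open>v\<close>
  play different roles, for a criterion symmetric in them; symmetry, transitivity and the link
  between reflexivity and totality are all read off from it.\<close>

lemma strong_extension_equiv_iff:
  assumes R: "equiv I R"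
  shows "(u, v) \<in> strong_extension I R \<longleftrightarrow>
    u \<in> beta_ultrafilters I \<and> v \<in> beta_ultrafilters I \<and> (\<exists>C\<in>I // R. C \<in> u \<and> C \<in> v)"
proof -
  have "{a \<in> I. {b \<in> I. (a, b) \<in> R} \<in> v} \<in> u \<longleftrightarrow> (\<exists>C\<in>I // R. C \<in> u \<and> C \<in> v)"
    if u: "u \<in> beta_ultrafilters I" and v: "v \<in> beta_ultrafilters I"
  proof -
    define S where "S = {a \<in> I. R `` {a} \<in> v}"
    have "{b \<in> I. (a, b) \<in> R} = R `` {a}" for a
      using equiv_type[OF R] by blast
    then have S: "{a \<in> I. {b \<in> I. (a, b) \<in> R} \<in> v} = S"
      by (simp add: S_def)
    \<comment> \<open>Each \<open>a\<close> in \<open>S\<close> has its class in \<open>v\<close>,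
      and \<open>v\<close> admits only one class, so this class is \<open>C\<close>; conversely
      every element of \<open>C\<close> has \<open>C\<close> as its class.\<close>
    have class_eq: "S = C" if "C \<in> I // R" "C \<in> v" for C
    proof (intro equalityI subsetI)
      fix a assume "a \<in> S"
      then have "a \<in> I" "R `` {a} \<in> v" by (auto simp: S_def)
      moreover from this have "R `` {a} = C"
        using beta_ultrafilters_quotient_unique[OF R v] that quotientI by metis
      ultimately show "a \<in> C"
        using equiv_class_self[OF R] by blast
    next
      fix a assume a: "a \<in> C"
      then have "a \<in> I"
        using in_quotient_imp_subset[OF R] that by blast
      moreover have "R `` {a} = C"
        using a that(1) R by (metis Image_singleton_iff equiv_class_eq quotientE)
      ultimately show "a \<in> S"
        using that by (simp add: S_def)
    qed
    show ?thesis
    proof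
      assume "{a \<in> I. {b \<in> I. (a, b) \<in> R} \<in> v} \<in> u"
      then have "S \<in> u" by (simp add: S)
      \<comment> \<open>As a member of \<open>u\<close>, \<open>S\<close> is nonempty, and the class
        of any of its elements lies in \<open>v\<close>. By \<open>class_eq\<close> this class is
        \<open>S\<close> itself, hence also in \<open>u\<close>.\<close>
      moreover from this obtain a where "a \<in> S"
        using beta_ultrafilters_Int_nonempty[OF u] by blast
      then have "R `` {a} \<in> I // R" "R `` {a} \<in> v"
        by (auto simp: S_def intro: quotientI)
      ultimately show "\<exists>C\<in>I // R. C \<in> u \<and> C \<in> v"
        using class_eq by blast
    qed (auto simp: S class_eq)
  qed
  then show ?thesis
    unfolding strong_extension_def by blast
qed

lemma sym_strong_extension:
  assumes "equiv I R"
  shows "sym (strong_extension I R)"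
  by (rule symI) (auto simp: strong_extension_equiv_iff[OF assms])

text \<open>The class shared by \<open>u\<close> and \<open>v\<close> and the one shared by
  \<open>v\<close> and \<open>w\<close> both lie in \<open>v\<close>, so they coincide.\<close>

lemma trans_strong_extension:
  assumes "equiv I R"
  shows "trans (strong_extension I R)"
proof (rule transI)
  fix u v w
  assume "(u, v) \<in> strong_extension I R" "(v, w) \<in> strong_extension I R"
  then show "(u, w) \<in> strong_extension I R"
    unfolding strong_extension_equiv_iff[OF assms]
    using beta_ultrafilters_quotient_unique[OF assms] by blast
qed

text \<open>If \<open>u\<close> is related to some \<open>v\<close>, the class they share already
  relates \<open>u\<close> to itself.\<close>

lemma refl_on_strong_extension_iff_total:
  assumes "equiv I R"
  shows "refl_on (beta_ultrafilters I) (strong_extension I R) \<longleftrightarrow>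
    total_relation (beta_ultrafilters I) (beta_ultrafilters I) (strong_extension I R)"
  unfolding refl_on_def total_relation_def strong_extension_equiv_iff[OF assms] by blast

theorem mainTheorem1:
  fixes I :: "'a set" and R :: "('a \<times> 'a) set"
  assumes "equiv I R"
  shows "(equiv (beta_ultrafilters I) (strong_extension I R)
            \<longleftrightarrow> refl_on (beta_ultrafilters I) (strong_extension I R)) \<and>
         (refl_on (beta_ultrafilters I) (strong_extension I R)
            \<longleftrightarrow> sym (strong_extension I R) \<and>
               total_relation (beta_ultrafilters I) (beta_ultrafilters I) (strong_extension I R)) \<and>
         (sym (strong_extension I R) \<and>
            total_relation (beta_ultrafilters I) (beta_ultrafilters I) (strong_extension I R)
            \<longleftrightarrow> total_relation (beta_ultrafilters I) (beta_ultrafilters I) (strong_extension I R))"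
proof -
  \<comment> \<open>An equivalence relation must also lie within its carrier. Symmetry and
    transitivity hold outright, so only reflexivity remains to be decided.\<close>
  have "strong_extension I R \<subseteq> beta_ultrafilters I \<times> beta_ultrafilters I"
    by (auto simp: strong_extension_def)
  then have "equiv (beta_ultrafilters I) (strong_extension I R) \<longleftrightarrow>
      refl_on (beta_ultrafilters I) (strong_extension I R)"
    using sym_strong_extension[OF assms] trans_strong_extension[OF assms]
    by (auto simp: equiv_def)
  then show ?thesis
    using sym_strong_extension[OF assms] refl_on_strong_extension_iff_total[OF assms] by blast
qed

end
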